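(* For $n\ge0$ let $R_n=\mathrm{ct}\left[(x^{-1}+1+x)^n(1-x)\right]$ (the Riordan numbers), and let $p$ be a prime. The asymptotic density $D_0$ of $0$ in $(R_n\bmod p)_{n\ge0}$ is $1$ if $p\mid T_n$ for some $0\le n<p$, and otherwise, for $p>2$, it is $$D_0=\frac{\left|\{0\le m<p-1 : 3T_m\equiv T_{p-1}T_{m+1}\}\right|+p\left|\{0\le m<p-1 : 3T_m\equiv T_{m+1}\}\right|}{(p-1)(p+1)},$$ where $m$ ranges over integers and congruences are modulo $p$. Additionally, for $p>2$, $D_0\geq\frac{1}{p-1}$.
   Context: For a Laurent polynomial $Q(x)$, $\mathrm{ct}[Q(x)]$ denotes its constant term. $T_n=\mathrm{ct}\left[(x^{-1}+1+x)^n\right]$ for $n\ge0$ (central trinomial coefficients). The sequence $R_n$ is OEIS A005043. The asymptotic density of a set $S\subseteq\mathbb{N}=\{0,1,2,\dots\}$ is $\lim_{N\to\infty}\frac{|S\cap\{n\in\mathbb{N}: n<N\}|}{N}$; the density of a value $x\in\mathbb{F}_p$ in a sequence $(c_n)$ over $\mathbb{F}_p$ is the asymptotic density of $\{n\in\mathbb{N}: c_n=x\}$. Saying that a density equals a number includes the assertion that the limit exists. *)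

theory Defs
  imports "HOL-Analysis.Analysis" "HOL-Library.Poly_Mapping" "HOL-Number_Theory.Number_Theory"
begin

text \<open>
  Integer Laurent polynomials are finitely supported maps from exponents to coefficients,
  multiplied by convolution.
\<close>

type_synonym laurent_poly = "int \<Rightarrow>\<^sub>0 int"

definition lp_X :: "int \<Rightarrow> laurent_poly" where
  "lp_X k = Poly_Mapping.single k 1"

definition ct :: "laurent_poly \<Rightarrow> int" where
  "ct Q = Poly_Mapping.lookup Q 0"

definition central_trinomial :: "nat \<Rightarrow> int" where
  "central_trinomial n = ct ((lp_X (-1) + 1 + lp_X 1) ^ n)"

definition riordan :: "nat \<Rightarrow> int" where
  "riordan n = ct ((lp_X (-1) + 1 + lp_X 1) ^ n * (1 - lp_X 1))"

definition has_asymptotic_density :: "nat set \<Rightarrow> real \<Rightarrow> bool" where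
  "has_asymptotic_density S d \<longleftrightarrow>
     (\<lambda>N. real (card (S \<inter> {n. n < N})) / real N) \<longlonglongrightarrow> d"

end

theory Submission
  imports Defs
begin

text \<open>
  Write T for the central trinomial coefficients. Then 2 R_n = 3 T_n - T_(n+1), and modulo p the
  Lucas congruence T_(kp+r) = T_k T_r holds for r < p. If p divides some T_m with m < p, then T_n
  vanishes modulo p unless the digit m is missing from the expansion of n, so almost always.

  Otherwise put u = T_(p-1), which is 1 or -1 modulo p, and consider the sets
  A = {n. 3 T_n = T_(n+1)} and B = {n. 3 T_n = u T_(n+1)}. Membership of k p + r in A or B depends
  only on r if r < p - 1, while k p + (p - 1) lies in A iff k lies in B, and in B iff k lies in A;
  this gives a linear system for the two densities. For the lower bound, 1 lies in A, and B contains
  1 if u = 1 and p - 2 if u = -1.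
\<close>

section \<open>Sets of natural numbers that are self-similar in base p\<close>

text \<open>Feeding a linear bound back into the recursion multiplies its slope by
  \<open>c / p\<close>, which is below 1, at the price of a larger additive constant. The slope
  therefore becomes arbitrarily small, and the constant vanishes after division by
  \<open>n\<close>.\<close>

lemma sublinear_of_digit_recursion:
  fixes g :: "nat \<Rightarrow> real" and p :: nat
  assumes "0 \<le> c" "c < real p" "0 \<le> L" "0 \<le> K"
    and nonneg: "\<And>n. 0 \<le> g n"
    and linear: "\<And>n. g n \<le> L * real n"
    and rec: "\<And>n. g n \<le> c * g (n div p) + K"
  shows "(\<lambda>n. g n / real n) \<longlonglongrightarrow> 0"
proof -
  define q where "q = c / real p"
  have q: "0 \<le> q" "q < 1" using assms(1,2) by (auto simp: q_def field_simps)
  have bound: "\<exists>C\<ge>0. \<forall>n. g n \<le> L * q ^ k * real n + C" for k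
  proof (induction k)
    case 0
    show ?case using linear by (intro exI[of _ 0]) auto
  next
    case (Suc k)
    then obtain C where C: "C \<ge> 0" "\<And>n. g n \<le> L * q ^ k * real n + C" by blast
    have "g n \<le> L * q ^ Suc k * real n + (c * C + K)" for n
    proof -
      have "g n \<le> c * g (n div p) + K" by (rule rec)
      also have "\<dots> \<le> c * (L * q ^ k * real (n div p) + C) + K"
        using C(2) assms(1) by (intro add_right_mono mult_left_mono) auto
      also have "\<dots> \<le> c * (L * q ^ k * (real n / real p) + C) + K"
        using assms q by (intro add_right_mono mult_left_mono of_nat_div_le_of_nat) auto
      also have "\<dots> = L * q ^ Suc k * real n + (c * C + K)"
        by (simp add: q_def field_simps)
      finally show ?thesis .
    qed
    moreover have "c * C + K \<ge> 0" using C assms by simp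
    ultimately show ?case by blast
  qed
  show ?thesis
  proof (rule LIMSEQ_I)
    fix e :: real assume e: "0 < e"
    have "(\<lambda>k. L * q ^ k) \<longlonglongrightarrow> L * 0"
      using q by (intro tendsto_mult tendsto_const LIMSEQ_power_zero) auto
    then have "\<forall>\<^sub>F k in sequentially. L * q ^ k < e / 2"
      using e by (intro order_tendstoD) auto
    then obtain k where k: "L * q ^ k < e / 2" by (auto simp: eventually_sequentially)
    obtain C where C: "C \<ge> 0" "\<And>n. g n \<le> L * q ^ k * real n + C" using bound by blast
    \<comment> \<open>Beyond \<open>M\<close> the constant \<open>C\<close> stays below
      \<open>e / 2 * n\<close>; the other half of \<open>e\<close> absorbs the slope.\<close>
    obtain M :: nat where M: "real M > 2 * C / e" using reals_Archimedean2 by blast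
    show "\<exists>no. \<forall>n\<ge>no. norm (g n / real n - 0) < e"
    proof (intro exI allI impI)
      fix n assume n: "Suc M \<le> n"
      have "2 * C / e < real n" using M n by linarith
      then have "C < e / 2 * real n" using e by (simp add: field_simps)
      moreover have "L * q ^ k * real n \<le> e / 2 * real n"
        using k by (intro mult_right_mono) auto
      ultimately have "g n < e * real n" using C(2)[of n] by (simp add: algebra_simps)
      then show "norm (g n / real n - 0) < e"
        using n nonneg[of n] by (simp add: field_simps)
    qed
  qed
qed

section \<open>Counting functions and their deviation from a linear function\<close>

definition count_below :: "nat set \<Rightarrow> nat \<Rightarrow> real" where
  "count_below S N = (\<Sum>n<N. of_bool (n \<in> S))"

lemma count_below_eq_card: "count_below S N = real (card (S \<inter> {n. n < N}))"
  unfolding count_below_def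
  by (simp add: sum.If_cases of_bool_def lessThan_def Int_commute)

lemma count_below_blocks:
  "count_below S (N * p) = (\<Sum>k<N. \<Sum>r<p. of_bool (k * p + r \<in> S))"
proof -
  have "(\<Sum>n=k*p..<k*p+p. of_bool (n \<in> S)) = (\<Sum>r<p. of_bool (k * p + r \<in> S) :: real)" for k
    using sum.shift_bounds_nat_ivl[of "\<lambda>n. of_bool (n \<in> S)" 0 "k*p" p]
    by (simp add: add.commute atLeast0LessThan del: sum_of_bool_eq)
  then show ?thesis
    unfolding count_below_def sum.nat_group[symmetric] by simp
qed

definition discrepancy :: "nat set \<Rightarrow> real \<Rightarrow> nat \<Rightarrow> real" where
  "discrepancy S d N = count_below S N - d * real N"

text \<open>Each further integer changes the discrepancy by \<open>1 - d\<close> or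
  \<open>- d\<close>. Rounding an argument down to a multiple of \<open>p\<close> thus costs only a
  bounded error.\<close>

lemma discrepancy_lipschitz:
  "\<bar>discrepancy S d (m + r) - discrepancy S d m\<bar> \<le> (1 + \<bar>d\<bar>) * real r"
proof (induction r)
  case (Suc r)
  have "discrepancy S d (m + Suc r) - discrepancy S d (m + r) = of_bool (m + r \<in> S) - d"
    by (simp add: discrepancy_def count_below_def algebra_simps)
  moreover have "\<bar>of_bool (m + r \<in> S) - d\<bar> \<le> 1 + \<bar>d\<bar>" by (cases "m + r \<in> S") auto
  ultimately have "\<bar>discrepancy S d (m + Suc r) - discrepancy S d (m + r)\<bar> \<le> 1 + \<bar>d\<bar>" by simp
  moreover have "(1 + \<bar>d\<bar>) * real (Suc r) = (1 + \<bar>d\<bar>) * real r + (1 + \<bar>d\<bar>)"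
    by (simp add: algebra_simps)
  ultimately show ?case using Suc by linarith
qed simp

lemma discrepancy_linear: "\<bar>discrepancy S d n\<bar> \<le> (1 + \<bar>d\<bar>) * real n"
  using discrepancy_lipschitz[of S d 0 n] by (simp add: discrepancy_def count_below_def)

lemma discrepancy_round_down:
  assumes "0 < p"
  shows "\<bar>discrepancy S d n\<bar> \<le> \<bar>discrepancy S d (n div p * p)\<bar> + (1 + \<bar>d\<bar>) * real p"
proof -
  have "\<bar>discrepancy S d n - discrepancy S d (n div p * p)\<bar> \<le> (1 + \<bar>d\<bar>) * real (n mod p)"
    using discrepancy_lipschitz[of S d "n div p * p" "n mod p"] by simp
  also have "\<dots> \<le> (1 + \<bar>d\<bar>) * real p"
    using assms by (intro mult_left_mono) auto
  finally show ?thesis by linarith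
qed

lemma has_asymptotic_densityI:
  assumes "(\<lambda>n. \<bar>discrepancy S d n\<bar> / real n) \<longlonglongrightarrow> 0"
  shows "has_asymptotic_density S d"
proof -
  have "(\<lambda>n. discrepancy S d n / real n) \<longlonglongrightarrow> 0"
    using assms by (subst tendsto_rabs_zero_iff[symmetric]) (simp)
  then have "(\<lambda>n. discrepancy S d n / real n + d) \<longlonglongrightarrow> 0 + d"
    by (intro tendsto_add tendsto_const)
  then have "(\<lambda>n. discrepancy S d n / real n + d) \<longlonglongrightarrow> d" by simp
  moreover have "\<forall>\<^sub>F n in sequentially.
      discrepancy S d n / real n + d = count_below S n / real n"
    using eventually_gt_at_top[of "0::nat"]
    by eventually_elim (simp add: discrepancy_def field_simps)
  ultimately show ?thesis
    unfolding has_asymptotic_density_def count_below_eq_card[symmetric]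
    by (rule Lim_transform_eventually)
qed

text \<open>The density is the solution of d = (a + d') / (q + 1), d' = (b + d) / (q + 1), so that
  passing from n to n div (q + 1) swaps the two discrepancies up to a bounded error.\<close>

lemma density_of_swapped_pair:
  fixes A B :: "nat set" and q :: nat
  assumes q: "0 < q"
    and A: "\<And>k r. r < q \<Longrightarrow> k * Suc q + r \<in> A \<longleftrightarrow> r \<in> A"
    and B: "\<And>k r. r < q \<Longrightarrow> k * Suc q + r \<in> B \<longleftrightarrow> r \<in> B"
    and AB: "\<And>k. k * Suc q + q \<in> A \<longleftrightarrow> k \<in> B"
    and BA: "\<And>k. k * Suc q + q \<in> B \<longleftrightarrow> k \<in> A"
  defines "a \<equiv> count_below A q" and "b \<equiv> count_below B q"
  shows "has_asymptotic_density A ((b + real (Suc q) * a) / (real q * (real q + 2)))"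
proof -
  define p where "p = Suc q"
  define D where "D = (b + real p * a) / (real q * (real q + 2))"
  define D' where "D' = (a + real p * b) / (real q * (real q + 2))"
  \<comment> \<open>The denominator is the determinant \<open>p^2 - 1\<close> of the linear system
    for the two densities \<open>D\<close> and \<open>D'\<close>.\<close>
  have E: "real q * (real q + 2) = real p * real p - 1" by (simp add: p_def algebra_simps)
  have "real q * (real q + 2) \<noteq> 0" using q by simp
  then have D: "real p * D = a + D'" and D': "real p * D' = b + D"
    unfolding D_def D'_def E by (simp_all add: field_simps)
  have "count_below A (N * p) = real N * a + count_below B N" for N
    unfolding count_below_blocks p_def
    by (simp add: A AB a_def count_below_def sum.distrib del: mult_Suc_right)
  then have eA: "discrepancy A D (N * p) = discrepancy B D' N" for N
    using arg_cong[OF D, of "\<lambda>x. real N * x"] by (simp add: discrepancy_def algebra_simps)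
  have "count_below B (N * p) = real N * b + count_below A N" for N
    unfolding count_below_blocks p_def
    by (simp add: B BA b_def count_below_def sum.distrib del: mult_Suc_right)
  then have eB: "discrepancy B D' (N * p) = discrepancy A D N" for N
    using arg_cong[OF D', of "\<lambda>x. real N * x"] by (simp add: discrepancy_def algebra_simps)
  \<comment> \<open>The sum of both absolute discrepancies is unaffected by the swap, so it
    satisfies a digit recursion with factor 1, which is less than \<open>p\<close>.\<close>
  define g where "g n = \<bar>discrepancy A D n\<bar> + \<bar>discrepancy B D' n\<bar>" for n
  have "(\<lambda>n. g n / real n) \<longlonglongrightarrow> 0"
  proof (rule sublinear_of_digit_recursion[where c = 1 and p = p
        and L = "2 + \<bar>D\<bar> + \<bar>D'\<bar>" and K = "(2 + \<bar>D\<bar> + \<bar>D'\<bar>) * real p"])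
    fix n
    have "g n \<le> (1 + \<bar>D\<bar>) * real n + (1 + \<bar>D'\<bar>) * real n"
      unfolding g_def by (intro add_mono discrepancy_linear)
    then show "g n \<le> (2 + \<bar>D\<bar> + \<bar>D'\<bar>) * real n" by (simp add: algebra_simps)
    have "g n \<le> (\<bar>discrepancy A D (n div p * p)\<bar> + (1 + \<bar>D\<bar>) * real p) +
        (\<bar>discrepancy B D' (n div p * p)\<bar> + (1 + \<bar>D'\<bar>) * real p)"
      unfolding g_def by (intro add_mono discrepancy_round_down) (simp_all add: p_def)
    also have "\<dots> = 1 * g (n div p) + (2 + \<bar>D\<bar> + \<bar>D'\<bar>) * real p"
      unfolding eA eB g_def by (simp add: algebra_simps)
    finally show "g n \<le> 1 * g (n div p) + (2 + \<bar>D\<bar> + \<bar>D'\<bar>) * real p" .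
  qed (use q in \<open>auto simp: g_def p_def\<close>)
  then have "(\<lambda>n. \<bar>discrepancy A D n\<bar> / real n) \<longlonglongrightarrow> 0"
    by (rule tendsto_sandwich[OF _ _ tendsto_const, rotated 2])
      (simp_all add: g_def divide_right_mono)
  then show ?thesis unfolding D_def p_def by (rule has_asymptotic_densityI)
qed

text \<open>A block of \<open>p\<close> consecutive integers with leading part \<open>k\<close>
  meets \<open>Z\<close> only if \<open>k\<close> is in \<open>Z\<close>, and then in at most
  \<open>p - 1\<close> places. Appending a digit multiplies the count by at most
  \<open>p - 1\<close> instead of \<open>p\<close>.\<close>

lemma missing_digit_sublinear:
  assumes m: "m < p"
    and hered: "\<And>k r. r < p \<Longrightarrow> k * p + r \<in> Z \<Longrightarrow> r \<noteq> m \<and> k \<in> Z"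
  shows "(\<lambda>n. count_below Z n / real n) \<longlonglongrightarrow> 0"
proof -
  have le: "count_below Z (N * p) \<le> real (p - 1) * count_below Z N" for N
  proof -
    have "(\<Sum>r<p. of_bool (k * p + r \<in> Z)) \<le> real (p - 1) * of_bool (k \<in> Z)" for k
    proof -
      have "(\<Sum>r<p. of_bool (k * p + r \<in> Z)) \<le> (\<Sum>r<p. of_bool (r \<noteq> m) * of_bool (k \<in> Z) :: real)"
        using hered by (intro sum_mono) auto
      also have "\<dots> = (\<Sum>r\<in>{..<p} - {m}. of_bool (k \<in> Z))"
        by (intro sum.mono_neutral_cong_right) auto
      also have "\<dots> = real (p - 1) * of_bool (k \<in> Z)" using m by simp
      finally show ?thesis .
    qed
    then show ?thesis
      unfolding count_below_blocks unfolding count_below_def sum_distrib_left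
      by (intro sum_mono)
  qed
  have disc: "discrepancy Z 0 = count_below Z" by (auto simp: discrepancy_def)
  have nonneg: "0 \<le> count_below Z n" for n by (simp add: count_below_eq_card)
  show ?thesis
  proof (rule sublinear_of_digit_recursion[where c = "real (p - 1)" and p = p
        and L = 1 and K = "real p"])
    show "count_below Z n \<le> 1 * real n" for n
      using discrepancy_linear[of Z 0 n] by (simp add: disc)
    show "count_below Z n \<le> real (p - 1) * count_below Z (n div p) + real p" for n
      using discrepancy_round_down[of p Z 0 n] le[of "n div p"] nonneg m by (simp add: disc)
  qed (use m nonneg in auto)
qed

section \<open>Coefficients of powers of the trinomial\<close>

definition trinomial :: laurent_poly where
  "trinomial = lp_X (-1) + 1 + lp_X 1"

text \<open>Off-centre coefficients are kept as well, since the recursion in \<open>n\<close> and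
  the congruences modulo \<open>p\<close> both leave the centre.\<close>

definition tri_coeff :: "nat \<Rightarrow> int \<Rightarrow> int" where
  "tri_coeff n j = Poly_Mapping.lookup (trinomial ^ n) j"

text \<open>Both sides are additive in \<open>Q\<close>, so it is enough to treat monomials with
  coefficient 1, which generate all Laurent polynomials under subtraction.\<close>

lemma lookup_lp_X_mult: "Poly_Mapping.lookup (lp_X k * Q) j = Poly_Mapping.lookup Q (j - k)"
proof -
  have "Poly_Mapping.keys Q \<subseteq> UNIV" by simp
  then show ?thesis
  proof (induction Q arbitrary: j rule: frag_induction)
    case (one x)
    show ?case by (auto simp: lp_X_def mult_single lookup_single when_def)
  next
    case (diff a b)
    then show ?case by (simp add: right_diff_distrib lookup_minus)
  qed simp
qed

lemma lookup_of_nat_mult: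
  fixes Q :: laurent_poly
  shows "Poly_Mapping.lookup (of_nat n * Q) j = int n * Poly_Mapping.lookup Q j"
  by (induction n) (simp_all add: distrib_right lookup_add)

lemma lp_X_power: "lp_X k ^ n = lp_X (int n * k)"
  by (induction n) (simp_all add: lp_X_def mult_single algebra_simps)

lemma lookup_trinomial_mult:
  "Poly_Mapping.lookup ((lp_X (- k) + 1 + lp_X k) * Q) j =
     Poly_Mapping.lookup Q (j - k) + Poly_Mapping.lookup Q j + Poly_Mapping.lookup Q (j + k)"
  by (simp add: distrib_right lookup_add lookup_lp_X_mult)

lemma tri_coeff_0: "tri_coeff 0 j = of_bool (j = 0)"
  by (simp add: tri_coeff_def lookup_one when_def)

lemma tri_coeff_Suc:
  "tri_coeff (Suc n) j = tri_coeff n (j - 1) + tri_coeff n j + tri_coeff n (j + 1)"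
  by (simp add: tri_coeff_def trinomial_def lookup_trinomial_mult)

lemma tri_coeff_uminus: "tri_coeff n (- j) = tri_coeff n j"
proof (induction n arbitrary: j)
  case (Suc n)
  show ?case
    using Suc[of "j - 1"] Suc[of "j + 1"] Suc[of j] by (simp add: tri_coeff_Suc)
qed (simp add: tri_coeff_0)

lemma tri_coeff_eq_0: "int n < \<bar>j\<bar> \<Longrightarrow> tri_coeff n j = 0"
  by (induction n arbitrary: j) (simp_all add: tri_coeff_0 tri_coeff_Suc)

lemma tri_coeff_lowest: "tri_coeff n (- int n) = 1"
  by (induction n) (simp_all add: tri_coeff_0 tri_coeff_Suc tri_coeff_eq_0)

lemma central_trinomial_eq: "central_trinomial n = tri_coeff n 0"
  by (simp add: central_trinomial_def ct_def tri_coeff_def trinomial_def)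

lemma central_trinomial_0: "central_trinomial 0 = 1"
  and central_trinomial_1: "central_trinomial 1 = 1"
  and central_trinomial_2: "central_trinomial 2 = 3"
  by (simp_all add: central_trinomial_eq tri_coeff_Suc tri_coeff_0 numeral_2_eq_2)

text \<open>Let \<open>t j\<close> be the coefficients of the \<open>n\<close>-th power. The factor
  \<open>1 - x\<close> gives \<open>t 0 - t (-1)\<close>, and by symmetry the next central
  coefficient is \<open>t 0 + 2 * t (-1)\<close>.\<close>

lemma two_riordan: "2 * riordan n = 3 * central_trinomial n - central_trinomial (Suc n)"
proof -
  have "riordan n = tri_coeff n 0 - Poly_Mapping.lookup (lp_X 1 * trinomial ^ n) 0"
    unfolding riordan_def ct_def trinomial_def[symmetric]
    by (simp add: right_diff_distrib lookup_minus tri_coeff_def mult.commute)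
  then have "riordan n = tri_coeff n 0 - tri_coeff n (- 1)"
    by (simp add: lookup_lp_X_mult tri_coeff_def)
  then show ?thesis
    using tri_coeff_uminus[of n 1] by (simp add: central_trinomial_eq tri_coeff_Suc)
qed

section \<open>Congruences modulo a prime\<close>

text \<open>The inner binomial coefficients are divisible by \<open>p\<close>. The explicit multiple
  of \<open>p\<close> lets the identity be used for Laurent polynomials and then read off
  coefficientwise.\<close>

lemma prime_power_add_cong:
  fixes x y :: "'a :: comm_ring_1"
  assumes "prime p"
  shows "\<exists>c. (x + y) ^ p = x ^ p + y ^ p + of_nat p * c"
proof -
  have p: "0 < p" using assms prime_gt_0_nat by blast
  have "(x + y) ^ p = (\<Sum>k\<le>p. of_nat (p choose k) * x ^ k * y ^ (p - k))"
    by (rule binomial_ring)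
  also have "{..p} = insert 0 (insert p {0<..<p})" using p by auto
  also have "(\<Sum>k\<in>\<dots>. of_nat (p choose k) * x ^ k * y ^ (p - k)) =
      x ^ p + y ^ p + (\<Sum>k\<in>{0<..<p}. of_nat (p choose k) * x ^ k * y ^ (p - k))"
    using p by simp
  also have "(\<Sum>k\<in>{0<..<p}. of_nat (p choose k) * x ^ k * y ^ (p - k)) =
      (\<Sum>k\<in>{0<..<p}. of_nat p * (of_nat ((p choose k) div p) * x ^ k * y ^ (p - k)))"
  proof (rule sum.cong)
    fix k assume "k \<in> {0<..<p}"
    then have "p dvd (p choose k)" using assms by (intro dvd_choose_prime) auto
    then have "of_nat (p choose k) = (of_nat p * of_nat ((p choose k) div p) :: 'a)"
      by (metis dvd_mult_div_cancel of_nat_mult)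
    then show "of_nat (p choose k) * x ^ k * y ^ (p - k) =
        of_nat p * (of_nat ((p choose k) div p) * x ^ k * y ^ (p - k))"
      by (simp add: mult.assoc)
  qed simp
  finally show ?thesis by (auto simp: sum_distrib_left[symmetric])
qed

context
  fixes p :: nat
  assumes prime: "prime p"
begin

text \<open>Modulo \<open>p\<close> the \<open>p\<close>-th power of the trinomial is the trinomial
  in \<open>x^p\<close>, so multiplying by it adds two copies shifted by \<open>p\<close>.\<close>

lemma tri_coeff_add_prime:
  "[tri_coeff (p + n) j = tri_coeff n (j - int p) + tri_coeff n j + tri_coeff n (j + int p)]
     (mod int p)"
proof -
  obtain c d :: laurent_poly where
    c: "(lp_X (- 1) + (1 + lp_X 1)) ^ p = lp_X (- 1) ^ p + (1 + lp_X 1) ^ p + of_nat p * c" and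
    d: "(1 + lp_X 1) ^ p = 1 ^ p + lp_X 1 ^ p + of_nat p * d"
    using prime_power_add_cong[OF prime] by meson
  have "trinomial ^ p = (lp_X (- int p) + 1 + lp_X (int p)) + of_nat p * (c + d)"
    using c d by (simp add: trinomial_def lp_X_power algebra_simps)
  then have "trinomial ^ (p + n) =
      (lp_X (- int p) + 1 + lp_X (int p)) * trinomial ^ n + of_nat p * ((c + d) * trinomial ^ n)"
    by (simp add: power_add algebra_simps)
  then show ?thesis
    unfolding tri_coeff_def
    by (simp add: lookup_add lookup_trinomial_mult lookup_of_nat_mult cong_def)
qed

text \<open>The restriction of the coefficients of the (k p + r)-th power to multiples of p satisfies
  modulo p the recursion of the coefficients of the k-th power.\<close>

lemma tri_coeff_lucas:
  assumes "r < p"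
  shows "[tri_coeff (k * p + r) (int p * j) = tri_coeff k j * tri_coeff r 0] (mod int p)"
proof (induction k arbitrary: j)
  case 0
  show ?case
  proof (cases "j = 0")
    case False
    \<comment> \<open>A nonzero multiple of \<open>p\<close> lies outside the support of the
      \<open>r\<close>-th power, because \<open>r < p\<close>.\<close>
    have "int p * 1 \<le> int p * \<bar>j\<bar>" using False by (intro mult_left_mono) auto
    then have "int r < \<bar>int p * j\<bar>" using assms unfolding abs_mult abs_of_nat by linarith
    then show ?thesis using False by (simp add: tri_coeff_0 tri_coeff_eq_0)
  qed (simp add: tri_coeff_0)
next
  case (Suc k)
  have "[tri_coeff (p + (k * p + r)) (int p * j) =
      tri_coeff (k * p + r) (int p * (j - 1)) + tri_coeff (k * p + r) (int p * j) +
      tri_coeff (k * p + r) (int p * (j + 1))] (mod int p)"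
    using tri_coeff_add_prime[of "k * p + r" "int p * j"] by (simp add: algebra_simps)
  moreover have "[tri_coeff (k * p + r) (int p * (j - 1)) + tri_coeff (k * p + r) (int p * j) +
      tri_coeff (k * p + r) (int p * (j + 1)) =
      tri_coeff k (j - 1) * tri_coeff r 0 + tri_coeff k j * tri_coeff r 0 +
      tri_coeff k (j + 1) * tri_coeff r 0] (mod int p)"
    by (intro cong_add Suc.IH)
  ultimately have "[tri_coeff (p + (k * p + r)) (int p * j) =
      tri_coeff k (j - 1) * tri_coeff r 0 + tri_coeff k j * tri_coeff r 0 +
      tri_coeff k (j + 1) * tri_coeff r 0] (mod int p)"
    by (rule cong_trans)
  then show ?case by (simp add: tri_coeff_Suc algebra_simps)
qed

lemma central_trinomial_lucas:
  assumes "r < p"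
  shows "[central_trinomial (k * p + r) = central_trinomial k * central_trinomial r] (mod int p)"
  using tri_coeff_lucas[OF assms, of k 0] by (simp add: central_trinomial_eq)

end

text \<open>The coefficients of 1 / (1 + x + x^2) and of its square. Modulo p they agree with the
  initial coefficients of (1 + x + x^2)^(p-1) and (1 + x + x^2)^(p-2), because
  (1 + x + x^2)^p is 1 up to terms of degree at least p.\<close>

fun inv_tri :: "nat \<Rightarrow> int" where
  "inv_tri 0 = 1"
| "inv_tri (Suc 0) = - 1"
| "inv_tri (Suc (Suc n)) = - inv_tri (Suc n) - inv_tri n"

fun inv_tri_sq :: "nat \<Rightarrow> int" where
  "inv_tri_sq 0 = 1"
| "inv_tri_sq (Suc 0) = - 2"
| "inv_tri_sq (Suc (Suc n)) = inv_tri (Suc (Suc n)) - inv_tri_sq (Suc n) - inv_tri_sq n"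

text \<open>This is the expansion of \<open>(1 - x) / (1 - x^3)\<close>.\<close>

lemma inv_tri_period:
  "inv_tri (3 * k) = 1" "inv_tri (3 * k + 1) = - 1" "inv_tri (3 * k + 2) = 0"
  by (induction k) (simp_all add: numeral_eq_Suc)

text \<open>These are coefficients of \<open>(1 - x)^2 / (1 - x^3)^2\<close>, where
  \<open>1 / (1 - x^3)^2\<close> has coefficient \<open>k + 1\<close> at
  \<open>x^(3k)\<close>.\<close>

lemma inv_tri_sq_values:
  "inv_tri_sq (3 * k) = int k + 1 \<and> inv_tri_sq (3 * k + 1) = - 2 * (int k + 1)"
proof (induction k)
  case (Suc k)
  have i: "inv_tri (3 * k) = 1" "inv_tri (Suc (3 * k)) = - 1"
    using inv_tri_period[of k] by simp_all
  have s: "inv_tri_sq (3 * k) = int k + 1" "inv_tri_sq (Suc (3 * k)) = - 2 * (int k + 1)"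
    using Suc by simp_all
  have "3 * Suc k = Suc (Suc (Suc (3 * k)))" "3 * Suc k + 1 = Suc (Suc (Suc (Suc (3 * k))))"
    by simp_all
  then show ?case by (simp only: inv_tri_sq.simps inv_tri.simps i s) simp
qed simp

context
  fixes p :: nat
  assumes prime: "prime p"
begin

lemma tri_coeff_prime_cong_0:
  assumes "- int p < j" "j < 0"
  shows "[tri_coeff p j = 0] (mod int p)"
  using tri_coeff_add_prime[OF prime, of 0 j] assms by (simp add: tri_coeff_0)

text \<open>The shift by \<open>p - 1\<close> makes \<open>i\<close> the degree in
  \<open>(1 + x + x^2)^(p-1)\<close>. One more factor gives row \<open>p\<close>, whose coefficients
  of degree 1 to \<open>p - 1\<close> vanish modulo \<open>p\<close>; this is the recursion of
  \<open>inv_tri\<close>.\<close>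

lemma tri_coeff_pred_prime:
  assumes "i < p"
  shows "[tri_coeff (p - 1) (int i - int (p - 1)) = inv_tri i] (mod int p)"
  using assms
proof (induction i rule: inv_tri.induct)
  case 1
  show ?case by (simp add: tri_coeff_lowest)
next
  case 2
  have "[tri_coeff p (1 - int p) = 0] (mod int p)"
    using 2 by (intro tri_coeff_prime_cong_0) auto
  moreover have "tri_coeff p (1 - int p) =
      tri_coeff (p - 1) (- int p) + tri_coeff (p - 1) (- int (p - 1)) + tri_coeff (p - 1) (2 - int p)"
    using tri_coeff_Suc[of "p - 1" "1 - int p"] 2 by simp
  ultimately have "[0 = 1 + tri_coeff (p - 1) (2 - int p)] (mod int p)"
    using 2 tri_coeff_lowest[of "p - 1"] by (simp add: tri_coeff_eq_0 cong_sym_eq)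
  then have "[0 + (- 1) = 1 + tri_coeff (p - 1) (2 - int p) + (- 1)] (mod int p)"
    by (intro cong_add) auto
  then show ?case using 2 by (simp add: cong_sym)
next
  case (3 n)
  define x where "x k = tri_coeff (p - 1) (int k - int (p - 1))" for k
  have IH: "[x n = inv_tri n] (mod int p)" "[x (Suc n) = inv_tri (Suc n)] (mod int p)"
    using 3 by (auto simp: x_def)
  have "[tri_coeff p (int (Suc n) - int (p - 1)) = 0] (mod int p)"
    using 3 by (intro tri_coeff_prime_cong_0) auto
  moreover have "tri_coeff p (int (Suc n) - int (p - 1)) = x n + x (Suc n) + x (Suc (Suc n))"
    using tri_coeff_Suc[of "p - 1" "int (Suc n) - int (p - 1)"] 3
    by (simp add: x_def algebra_simps)
  ultimately have "[x n + x (Suc n) + x (Suc (Suc n)) - x (Suc n) - x n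
      = 0 - inv_tri (Suc n) - inv_tri n] (mod int p)"
    using IH by (intro cong_diff) auto
  then show ?case by (simp add: x_def)
qed

text \<open>One row lower the same argument applies with the known row \<open>p - 1\<close> in place
  of zeros, so \<open>inv_tri\<close> enters as the inhomogeneous term.\<close>

lemma tri_coeff_pred_pred_prime:
  assumes "i < p - 1"
  shows "[tri_coeff (p - 2) (int i - int (p - 2)) = inv_tri_sq i] (mod int p)"
  using assms
proof (induction i rule: inv_tri.induct)
  case 1
  show ?case by (simp add: tri_coeff_lowest)
next
  case 2
  have p: "p - 1 = Suc (p - 2)" "int (p - 1) = int p - 1" "int (p - 2) = int p - 2" using 2 by auto
  have "tri_coeff (p - 1) (2 - int p) =
      tri_coeff (p - 2) (1 - int p) + tri_coeff (p - 2) (2 - int p) + tri_coeff (p - 2) (3 - int p)"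
    unfolding p(1) tri_coeff_Suc by simp
  moreover have "tri_coeff (p - 2) (1 - int p) = 0" using 2 by (intro tri_coeff_eq_0) auto
  moreover have "tri_coeff (p - 2) (2 - int p) = 1"
    using tri_coeff_lowest[of "p - 2"] p by simp
  moreover have "[tri_coeff (p - 1) (2 - int p) = - 1] (mod int p)"
    using tri_coeff_pred_prime[of 1] 2 p by simp
  ultimately have "[1 + tri_coeff (p - 2) (3 - int p) - 1 = - 1 - 1] (mod int p)"
    by (intro cong_diff) auto
  then show ?case using p by simp
next
  case (3 n)
  have p: "p - 1 = Suc (p - 2)" "int (p - 1) = int p - 1" "int (p - 2) = int p - 2" using 3 by auto
  define x where "x k = tri_coeff (p - 2) (int k - int (p - 2))" for k
  have IH: "[x n = inv_tri_sq n] (mod int p)" "[x (Suc n) = inv_tri_sq (Suc n)] (mod int p)"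
    using 3 by (auto simp: x_def)
  have "[tri_coeff (p - 1) (int (Suc (Suc n)) - int (p - 1)) = inv_tri (Suc (Suc n))] (mod int p)"
    using 3 by (intro tri_coeff_pred_prime) auto
  moreover have "tri_coeff (p - 1) (int (Suc (Suc n)) - int (p - 1)) =
      x n + x (Suc n) + x (Suc (Suc n))"
    using tri_coeff_Suc[of "p - 2" "int (Suc (Suc n)) - int (p - 1)"] p
    by (simp add: x_def algebra_simps)
  ultimately have "[x n + x (Suc n) + x (Suc (Suc n)) - x (Suc n) - x n
      = inv_tri (Suc (Suc n)) - inv_tri_sq (Suc n) - inv_tri_sq n] (mod int p)"
    using IH by (intro cong_diff) auto
  then show ?case by (simp add: x_def)
qed

lemma central_trinomial_pred_prime: "[central_trinomial (p - 1) = inv_tri (p - 1)] (mod int p)"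
  using tri_coeff_pred_prime[of "p - 1"] prime_gt_0_nat[OF prime]
  by (simp add: central_trinomial_eq)

text \<open>The residue of \<open>p\<close> modulo 3 decides: 1 gives the value 1, 2 gives -1, and 0
  gives the excluded value 0.\<close>

lemma central_trinomial_pred_prime_cases:
  assumes "\<not> int p dvd central_trinomial (p - 1)"
  shows "[central_trinomial (p - 1) = 1] (mod int p) \<or>
    (\<exists>k. p = 3 * k + 2) \<and> [central_trinomial (p - 1) = - 1] (mod int p)"
proof -
  define k where "k = (p - 1) div 3"
  have k: "p - 1 = 3 * k + (p - 1) mod 3" by (simp add: k_def)
  have "p > 0" using prime prime_gt_0_nat by blast
  consider "(p - 1) mod 3 = 0" | "(p - 1) mod 3 = 1" | "(p - 1) mod 3 = 2"
    by fastforce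
  then show ?thesis
  proof cases
    case 1
    then show ?thesis using k inv_tri_period[of k] central_trinomial_pred_prime by simp
  next
    case 2
    then have "p - 1 = 3 * k + 1" using k by simp
    then show ?thesis using inv_tri_period[of k] central_trinomial_pred_prime \<open>p > 0\<close>
      by (intro disjI2 conjI exI[of _ k]) auto
  next
    case 3
    then have "inv_tri (p - 1) = 0" using k inv_tri_period[of k] by simp
    then show ?thesis
      using central_trinomial_pred_prime assms by (simp add: cong_0_iff)
  qed
qed

text \<open>The central degree is \<open>p - 2 = 3 * k\<close>, where \<open>inv_tri_sq\<close>
  equals \<open>k + 1\<close>, and \<open>3 * (k + 1) = p + 1\<close>.\<close>

lemma three_central_trinomial_pred_pred:
  assumes "p = 3 * k + 2"
  shows "[3 * central_trinomial (p - 2) = 1] (mod int p)"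
proof -
  have "[central_trinomial (p - 2) = inv_tri_sq (3 * k)] (mod int p)"
    using tri_coeff_pred_pred_prime[of "3 * k"] assms by (simp add: central_trinomial_eq)
  then have "[3 * central_trinomial (p - 2) = 3 * (int k + 1)] (mod int p)"
    using cong_scalar_left[of _ _ "int p" 3] inv_tri_sq_values[of k] by fastforce
  also have "3 * (int k + 1) = int p + 1" using assms by simp
  also have "[int p + 1 = 1] (mod int p)" by (simp add: cong_def)
  finally show ?thesis .
qed

end

section \<open>The density of zeros of the Riordan numbers\<close>

lemma riordan_cong_0_iff:
  assumes "prime p" "p > 2"
  shows "[riordan n = 0] (mod int p) \<longleftrightarrow>
    [3 * central_trinomial n = central_trinomial (Suc n)] (mod int p)"
proof -
  have "coprime 2 (int p)"
    using assms by (metis coprime_left_2_iff_odd even_of_nat prime_odd_nat)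
  then have "int p dvd riordan n \<longleftrightarrow> int p dvd 2 * riordan n"
    by (simp add: coprime_commute coprime_dvd_mult_right_iff)
  then show ?thesis by (simp add: two_riordan cong_0_iff cong_iff_dvd_diff)
qed

text \<open>A nonzero \<open>riordan n\<close> modulo \<open>p\<close> forces \<open>T_n\<close> or
  \<open>T_(n+1)\<close> to be nonzero, so the exceptions lie in a sparse set and its shift by
  one.\<close>

lemma riordan_density_1:
  assumes prime: "prime p" and m: "m < p" "int p dvd central_trinomial m"
  shows "has_asymptotic_density {n. [riordan n = 0] (mod int p)} 1" (is "has_asymptotic_density ?S 1")
proof -
  \<comment> \<open>For \<open>p = 2\<close> the hypothesis fails, since both central trinomial
    coefficients with index below 2 equal 1.\<close>
  have "p > 2"
  proof (rule ccontr)
    assume "\<not> p > 2"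
    then have "p = 2" using prime_ge_2_nat[OF prime] by simp
    then show False
      using m central_trinomial_0 central_trinomial_1 by (auto simp: less_2_cases_iff)
  qed
  define Z where "Z = {n. \<not> int p dvd central_trinomial n}"
  have "(\<lambda>n. count_below Z n / real n) \<longlonglongrightarrow> 0"
  proof (rule missing_digit_sublinear[OF m(1)])
    fix k r assume "r < p" "k * p + r \<in> Z"
    then have "\<not> int p dvd central_trinomial k * central_trinomial r"
      using central_trinomial_lucas[OF prime] unfolding Z_def by (metis cong_dvd_iff mem_Collect_eq)
    then show "r \<noteq> m \<and> k \<in> Z" using m by (auto simp: Z_def)
  qed
  then have "(\<lambda>n. 2 * (count_below Z n / real n) + 1 / real n) \<longlonglongrightarrow> 2 * 0 + 0"
    by (intro tendsto_intros lim_1_over_n)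
  then have lim: "(\<lambda>n. 2 * (count_below Z n / real n) + 1 / real n) \<longlonglongrightarrow> 0" by simp
  have zero: "n \<in> ?S" if "n \<notin> Z" "Suc n \<notin> Z" for n
    using that riordan_cong_0_iff[OF prime \<open>p > 2\<close>]
    by (simp add: Z_def cong_iff_dvd_diff)
  have shift: "(\<Sum>n<N. of_bool (Suc n \<in> Z)) \<le> count_below Z N + 1" for N
  proof -
    have "(\<Sum>n<N. of_bool (Suc n \<in> Z)) \<le> count_below Z (Suc N)"
      unfolding count_below_def sum.lessThan_Suc_shift by (simp del: sum_of_bool_eq)
    also have "\<dots> \<le> count_below Z N + 1" by (simp add: count_below_def del: sum_of_bool_eq)
    finally show ?thesis .
  qed
  have "\<bar>discrepancy ?S 1 N\<bar> \<le> 2 * count_below Z N + 1" for N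
  proof -
    have "\<bar>discrepancy ?S 1 N\<bar> = \<bar>\<Sum>n<N. of_bool (n \<in> ?S) - (1::real)\<bar>"
      by (simp add: discrepancy_def count_below_def sum_subtractf)
    also have "\<dots> \<le> (\<Sum>n<N. \<bar>of_bool (n \<in> ?S) - (1::real)\<bar>)" by (rule sum_abs)
    also have "\<dots> \<le> (\<Sum>n<N. of_bool (n \<in> Z) + of_bool (Suc n \<in> Z))"
      using zero by (intro sum_mono) (auto simp: of_bool_def)
    also have "\<dots> \<le> 2 * count_below Z N + 1"
      using shift[of N] by (simp add: sum.distrib count_below_def)
    finally show ?thesis .
  qed
  then have le: "\<bar>discrepancy ?S 1 N\<bar> / real N \<le> 2 * (count_below Z N / real N) + 1 / real N" for N
    using divide_right_mono[of _ _ "real N"] by (fastforce simp: add_divide_distrib)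
  from lim have "(\<lambda>n. \<bar>discrepancy ?S 1 n\<bar> / real n) \<longlonglongrightarrow> 0"
    by (rule tendsto_sandwich[OF _ _ tendsto_const, rotated 2]) (use le in simp_all)
  then show ?thesis by (rule has_asymptotic_densityI)
qed

section \<open>Primes dividing none of the central trinomial coefficients\<close>

locale nondivisible_prime =
  fixes p :: nat
  assumes prime: "prime p" and gt_2: "p > 2"
    and nondvd_digit: "\<And>n. n < p \<Longrightarrow> \<not> int p dvd central_trinomial n"
begin

abbreviation T where "T \<equiv> central_trinomial"

definition A where "A = {n. [3 * T n = T (n + 1)] (mod int p)}"

definition B where "B = {n. [3 * T n = T (p - 1) * T (n + 1)] (mod int p)}"

text \<open>Stripping the last digit, the Lucas congruence and primality carry nondivisibility from
  digits to all \<open>n\<close>. Hence every \<open>T k\<close> can be cancelled modulo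
  \<open>p\<close>.\<close>

lemma nondvd: "\<not> int p dvd T n"
proof (induction n rule: less_induct)
  case (less n)
  show ?case
  proof (cases "n < p")
    case False
    then have "n div p < n" "n mod p < p" using gt_2 by auto
    then have *: "\<not> int p dvd T (n div p)" "\<not> int p dvd T (n mod p)"
      using less nondvd_digit by auto
    have "[T n = T (n div p) * T (n mod p)] (mod int p)"
      using central_trinomial_lucas[OF prime, of "n mod p" "n div p"] gt_2 by simp
    moreover have "\<not> int p dvd T (n div p) * T (n mod p)"
      using * prime by (simp add: prime_dvd_mult_iff)
    ultimately show ?thesis by (metis cong_dvd_iff)
  qed (rule nondvd_digit)
qed

lemma cancel: "[T k * x = T k * y] (mod int p) \<longleftrightarrow> [x = y] (mod int p)"
proof -
  have "int p dvd T k * (x - y) \<longleftrightarrow> int p dvd x - y"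
    using nondvd[of k] prime by (simp add: prime_dvd_mult_iff)
  then show ?thesis by (simp add: cong_iff_dvd_diff right_diff_distrib)
qed

lemma T_pred_cases:
  "[T (p - 1) = 1] (mod int p) \<or>
    (\<exists>k. p = 3 * k + 2) \<and> [T (p - 1) = - 1] (mod int p)"
  using central_trinomial_pred_prime_cases[OF prime] nondvd by blast

lemma T_pred_sq: "[T (p - 1) * T (p - 1) = 1] (mod int p)"
  using T_pred_cases cong_mult[of "T (p - 1)" _ "int p" "T (p - 1)"] by fastforce

text \<open>For \<open>r < p - 1\<close> adding 1 causes no carry, so both sides share the unit
  \<open>T k\<close>. The cases \<open>c = 1\<close> and \<open>c = T (p - 1)\<close> serve
  \<open>A\<close> and \<open>B\<close>.\<close>

lemma digit_cong:
  assumes "r < p - 1"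
  shows "[3 * T (k * p + r) = c * T (k * p + r + 1)] (mod int p) \<longleftrightarrow>
    [3 * T r = c * T (r + 1)] (mod int p)"
proof -
  have "[3 * T (k * p + r) = 3 * (T k * T r)] (mod int p)"
    "[c * T (k * p + (r + 1)) = c * (T k * T (r + 1))] (mod int p)"
    using assms by (intro cong_scalar_left central_trinomial_lucas[OF prime]; simp)+
  then have "[3 * T (k * p + r) = c * T (k * p + r + 1)] (mod int p) \<longleftrightarrow>
      [3 * (T k * T r) = c * (T k * T (r + 1))] (mod int p)"
    by (simp add: cong_def)
  also have "\<dots> \<longleftrightarrow> [T k * (3 * T r) = T k * (c * T (r + 1))] (mod int p)"
    by (simp add: mult.left_commute)
  finally show ?thesis by (simp only: cancel)
qed

text \<open>Here adding 1 carries into \<open>k\<close>, leaving \<open>T (k + 1)\<close> on the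
  right. Multiplying by \<open>T (p - 1)\<close>, whose square is 1, moves that factor to the right;
  this exchanges the conditions of \<open>A\<close> and \<open>B\<close>.\<close>

lemma last_digit_cong:
  "[3 * T (k * p + (p - 1)) = c * T (k * p + (p - 1) + 1)] (mod int p) \<longleftrightarrow>
    [3 * T k = T (p - 1) * c * T (k + 1)] (mod int p)"
proof -
  have 1: "[3 * T (k * p + (p - 1)) = 3 * (T k * T (p - 1))] (mod int p)"
    using gt_2 by (intro cong_scalar_left central_trinomial_lucas[OF prime]) auto
  have "k * p + (p - 1) + 1 = Suc k * p + 0" using gt_2 by simp
  then have 2: "[T (k * p + (p - 1) + 1) = T (k + 1)] (mod int p)"
    using central_trinomial_lucas[OF prime, of 0 "Suc k"] gt_2
    by (simp only: central_trinomial_0) simp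
  have "[3 * T (k * p + (p - 1)) = c * T (k * p + (p - 1) + 1)] (mod int p) \<longleftrightarrow>
      [3 * (T k * T (p - 1)) = c * T (k + 1)] (mod int p)"
    using 1 cong_scalar_left[OF 2, of c] by (simp add: cong_def)
  also have "\<dots> \<longleftrightarrow>
      [T (p - 1) * (3 * (T k * T (p - 1))) = T (p - 1) * (c * T (k + 1))] (mod int p)"
    by (simp only: cancel)
  also have "\<dots> \<longleftrightarrow>
      [(T (p - 1) * T (p - 1)) * (3 * T k) = T (p - 1) * c * T (k + 1)] (mod int p)"
    by (simp add: algebra_simps)
  also have "\<dots> \<longleftrightarrow> [3 * T k = T (p - 1) * c * T (k + 1)] (mod int p)"
    using cong_scalar_right[OF T_pred_sq, of "3 * T k"] by (simp add: cong_def)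
  finally show ?thesis .
qed

lemma density_A:
  "has_asymptotic_density A
     ((count_below B (p - 1) + real p * count_below A (p - 1)) / ((real p - 1) * (real p + 1)))"
proof -
  have p: "Suc (p - 1) = p" "real (p - 1) = real p - 1" using gt_2 by auto
  have "k * p + (p - 1) \<in> B \<longleftrightarrow> k \<in> A" for k
  proof -
    have "[T (p - 1) * T (p - 1) * T (k + 1) = T (k + 1)] (mod int p)"
      using cong_scalar_right[OF T_pred_sq, of "T (k + 1)"] by simp
    then show ?thesis
      unfolding A_def B_def mem_Collect_eq last_digit_cong by (simp add: cong_def)
  qed
  moreover have "k * p + (p - 1) \<in> A \<longleftrightarrow> k \<in> B" for k
    using last_digit_cong[of k 1] by (simp add: A_def B_def)
  moreover have "k * p + r \<in> A \<longleftrightarrow> r \<in> A" if "r < p - 1" for k r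
    using digit_cong[OF that, of k 1] by (simp add: A_def)
  moreover have "k * p + r \<in> B \<longleftrightarrow> r \<in> B" if "r < p - 1" for k r
    using digit_cong[OF that, of k "T (p - 1)"] by (simp add: B_def)
  ultimately show ?thesis
    using density_of_swapped_pair[of "p - 1" A B] gt_2 unfolding p by (simp add: algebra_simps)
qed

lemma one_in_A: "1 \<in> A"
  using central_trinomial_1 central_trinomial_2 by (simp add: A_def numeral_2_eq_2)

lemma B_nonempty: "\<exists>m<p - 1. m \<in> B"
  using T_pred_cases
proof (elim disjE conjE exE)
  \<comment> \<open>In this case the conditions defining \<open>A\<close> and \<open>B\<close>
    coincide.\<close>
  assume "[T (p - 1) = 1] (mod int p)"
  then have "1 \<in> B"
    using one_in_A cong_scalar_right[of "T (p - 1)" 1 "int p" "T 2"]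
    by (simp add: A_def B_def cong_def numeral_2_eq_2)
  then show ?thesis using gt_2 by (intro exI[of _ 1]) auto
next
  fix k assume "p = 3 * k + 2"
  \<comment> \<open>At \<open>m = p - 2\<close> the right side of the condition for \<open>B\<close>
    is the square of \<open>T (p - 1)\<close>, which is 1.\<close>
  then have "[3 * T (p - 2) = 1] (mod int p)" by (rule three_central_trinomial_pred_pred[OF prime])
  also have "[1 = T (p - 1) * T (p - 1)] (mod int p)" using T_pred_sq by (rule cong_sym)
  also have "p - 1 = p - 2 + 1" using gt_2 by simp
  finally have "p - 2 \<in> B" using gt_2 by (simp add: B_def numeral_2_eq_2 Suc_diff_Suc)
  then show ?thesis using gt_2 by (intro exI[of _ "p - 2"]) auto
qed

text \<open>One element in each of the two sets makes the numerator at least \<open>p + 1\<close>,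
  which cancels against the denominator.\<close>

lemma density_ge:
  "(count_below B (p - 1) + real p * count_below A (p - 1)) / ((real p - 1) * (real p + 1))
     \<ge> 1 / (real p - 1)"
proof -
  have ge: "count_below S N \<ge> 1" if "m < N" "m \<in> S" for S m N
  proof -
    have "card (S \<inter> {n. n < N}) > 0" using that by (auto simp: card_gt_0_iff)
    then show ?thesis by (simp add: count_below_eq_card)
  qed
  have "count_below A (p - 1) \<ge> 1" using one_in_A gt_2 by (intro ge[of 1]) auto
  then have "real p * count_below A (p - 1) \<ge> real p * 1" by (intro mult_left_mono) auto
  moreover have "count_below B (p - 1) \<ge> 1" using B_nonempty ge by blast
  ultimately have "real p + 1 \<le> count_below B (p - 1) + real p * count_below A (p - 1)" by simp
  then have "(real p + 1) / ((real p - 1) * (real p + 1)) \<le>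
      (count_below B (p - 1) + real p * count_below A (p - 1)) / ((real p - 1) * (real p + 1))"
    using gt_2 by (intro divide_right_mono) auto
  then show ?thesis by simp
qed

end

theorem proposition15:
  fixes p :: nat
  assumes "prime p"
  shows "((\<exists>n<p. int p dvd central_trinomial n) \<longrightarrow>
            has_asymptotic_density {n. [riordan n = 0] (mod int p)} 1) \<and>
         (\<not> (\<exists>n<p. int p dvd central_trinomial n) \<and> p > 2 \<longrightarrow>
            has_asymptotic_density {n. [riordan n = 0] (mod int p)}
              ((real (card {m. m < p - 1 \<and>
                    [3 * central_trinomial m
                      = central_trinomial (p - 1) * central_trinomial (m + 1)] (mod int p)})
                + real p * real (card {m. m < p - 1 \<and>
                    [3 * central_trinomial m = central_trinomial (m + 1)] (mod int p)}))
               / ((real p - 1) * (real p + 1)))) \<and>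
         (p > 2 \<longrightarrow>
            (\<exists>D\<^sub>0. has_asymptotic_density {n. [riordan n = 0] (mod int p)} D\<^sub>0 \<and>
                  D\<^sub>0 \<ge> 1 / (real p - 1)))"
proof (cases "\<exists>n<p. int p dvd central_trinomial n")
  case True
  then have "has_asymptotic_density {n. [riordan n = 0] (mod int p)} 1"
    using riordan_density_1[OF assms] by blast
  moreover have "p > 2 \<Longrightarrow> 1 / (real p - 1) \<le> 1" by simp
  ultimately show ?thesis using True by blast
next
  case nodvd: False
  show ?thesis
  proof (cases "p > 2")
    case True
    interpret nondivisible_prime p using assms True nodvd by unfold_locales auto
    have "{n. [riordan n = 0] (mod int p)} = A"
      using riordan_cong_0_iff[OF assms True] by (simp add: A_def)
    moreover have
      "count_below B (p - 1) = real (card {m. m < p - 1 \<and>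
          [3 * central_trinomial m
            = central_trinomial (p - 1) * central_trinomial (m + 1)] (mod int p)})"
      "count_below A (p - 1) = real (card {m. m < p - 1 \<and>
          [3 * central_trinomial m = central_trinomial (m + 1)] (mod int p)})"
      unfolding count_below_eq_card A_def B_def
      by (auto intro!: arg_cong[of _ _ card])
    ultimately show ?thesis using nodvd density_A density_ge by auto
  \<comment> \<open>For \<open>p = 2\<close> without a divisible coefficient all three implications
    are vacuous.\<close>
  qed (use nodvd in blast)
qed

end
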